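(* If a polarised manifold $(X,E)$ has the polarised density property, then so does $(X,E^{\otimes k})$ for every positive tensor power $E^{\otimes k}$, $k>0$.
   Context: A polarised manifold is a pair $(X,E)$ of a compact complex manifold $X$ and an ample holomorphic line bundle $E$ on $X$. $|E|$ is the complete linear system of $E$: its elements are the divisors of nontrivial holomorphic sections of $E$; a divisor is identified with its support when taking complements. The polarised manifold $(X,E)$ has the polarised density property if for each point $x\in X$ there exists a divisor $D\in|E|$ whose complement $X\setminus D$ is a Stein neighbourhood of $x$ with the density property. A holomorphic vector field on a complex manifold is complete if its flow exists for all complex values of time. A complex manifold has the density property if every holomorphic vector field on it can be approximated uniformly on compacts by sums and commutators of complete holomorphic vector fields. *)

theory Defs
  imports "HOL-Analysis.Analysis"
begin

section \<open>Holomorphic functions of several variables\<close>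

text \<open>The complex analogue of the library's \<^const>\<open>Euclidean_space\<close>: the dimension is a natural number
  rather than a type, so that it can be quantified, and can be 0.\<close>

definition complex_space :: "nat \<Rightarrow> (nat \<Rightarrow> complex) topology" where
  "complex_space n = subtopology (product_topology (\<lambda>_. euclidean) UNIV) {z. \<forall>i\<ge>n. z i = 0}"

text \<open>Used for open subsets \<open>S\<close> of \<open>\<complex>\<^sup>n\<close>: continuous, and holomorphic in each variable
  separately (for such functions, Osgood's lemma gives local power series expansions).\<close>

definition holomorphic_Cn :: "nat \<Rightarrow> (nat \<Rightarrow> complex) set \<Rightarrow> ((nat \<Rightarrow> complex) \<Rightarrow> complex) \<Rightarrow> bool" where
  "holomorphic_Cn n S f \<longleftrightarrow>
     continuous_map (subtopology (complex_space n) S) euclidean f \<and>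
     (\<forall>z\<in>S. \<forall>i<n. (\<lambda>t. f (z(i := t))) field_differentiable at (z i))"


section \<open>Complex manifolds\<close>

text \<open>A chart is a domain together with a coordinate map; the values of the coordinate map outside
  the domain are irrelevant. The atlas is not required to be maximal.\<close>

type_synonym 'a cchart = "'a set \<times> ('a \<Rightarrow> nat \<Rightarrow> complex)"

record 'a cmanifold =
  cdim :: nat
  ctop :: "'a topology"
  catlas :: "'a cchart set"

abbreviation cpoints :: "'a cmanifold \<Rightarrow> 'a set" where
  "cpoints X \<equiv> topspace (ctop X)"

definition complex_manifold :: "'a cmanifold \<Rightarrow> bool" where
  "complex_manifold X \<longleftrightarrow>
     Hausdorff_space (ctop X) \<and> second_countable (ctop X) \<and>
     (\<Union>(U, \<phi>)\<in>catlas X. U) = cpoints X \<and>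
     (\<forall>(U, \<phi>)\<in>catlas X.
        openin (ctop X) U \<and> openin (complex_space (cdim X)) (\<phi> ` U) \<and>
        homeomorphic_map (subtopology (ctop X) U) (subtopology (complex_space (cdim X)) (\<phi> ` U)) \<phi>) \<and>
     (\<forall>(U, \<phi>)\<in>catlas X. \<forall>(V, \<psi>)\<in>catlas X. \<forall>i<cdim X.
        holomorphic_Cn (cdim X) (\<phi> ` (U \<inter> V)) (\<lambda>z. \<psi> (inv_into U \<phi> z) i))"

definition open_submanifold :: "'a cmanifold \<Rightarrow> 'a set \<Rightarrow> 'a cmanifold" where
  "open_submanifold X W =
     \<lparr>cdim = cdim X, ctop = subtopology (ctop X) W, catlas = (\<lambda>(U, \<phi>). (U \<inter> W, \<phi>)) ` catlas X\<rparr>"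

definition holomorphic_fun_on :: "'a cmanifold \<Rightarrow> 'a set \<Rightarrow> ('a \<Rightarrow> complex) \<Rightarrow> bool" where
  "holomorphic_fun_on X W f \<longleftrightarrow>
     (\<forall>(U, \<phi>)\<in>catlas X. holomorphic_Cn (cdim X) (\<phi> ` (U \<inter> W)) (\<lambda>z. f (inv_into U \<phi> z)))"

abbreviation holomorphic_functions :: "'a cmanifold \<Rightarrow> ('a \<Rightarrow> complex) set" where
  "holomorphic_functions X \<equiv> {f. holomorphic_fun_on X (cpoints X) f}"

text \<open>The partial derivative at \<open>p\<close> of \<open>f\<close> with respect to the \<open>j\<close>-th coordinate of the chart.\<close>

definition chart_pd :: "'a cchart \<Rightarrow> nat \<Rightarrow> ('a \<Rightarrow> complex) \<Rightarrow> 'a \<Rightarrow> complex" where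
  "chart_pd c j f p = deriv (\<lambda>t. f (inv_into (fst c) (snd c) ((snd c p)(j := t)))) (snd c p j)"

definition holomorphic_map :: "'a cmanifold \<Rightarrow> 'b cmanifold \<Rightarrow> ('a \<Rightarrow> 'b) \<Rightarrow> bool" where
  "holomorphic_map X Y f \<longleftrightarrow>
     continuous_map (ctop X) (ctop Y) f \<and>
     (\<forall>(U, \<phi>)\<in>catlas X. \<forall>(V, \<psi>)\<in>catlas Y. \<forall>i<cdim Y.
        holomorphic_Cn (cdim X) (\<phi> ` {p\<in>U. f p \<in> V}) (\<lambda>z. \<psi> (f (inv_into U \<phi> z)) i))"

definition immersive :: "'a cmanifold \<Rightarrow> 'b cmanifold \<Rightarrow> ('a \<Rightarrow> 'b) \<Rightarrow> bool" where
  "immersive X Y f \<longleftrightarrow>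
     (\<forall>p\<in>cpoints X. \<forall>c\<in>catlas X. \<forall>d\<in>catlas Y. p \<in> fst c \<longrightarrow> f p \<in> fst d \<longrightarrow>
        (\<forall>v :: nat \<Rightarrow> complex.
           (\<forall>i<cdim Y. (\<Sum>j<cdim X. chart_pd c j (\<lambda>q. snd d (f q) i) p * v j) = 0) \<longrightarrow>
           (\<forall>j<cdim X. v j = 0)))"

definition holomorphic_embedding :: "'a cmanifold \<Rightarrow> 'b cmanifold \<Rightarrow> ('a \<Rightarrow> 'b) \<Rightarrow> bool" where
  "holomorphic_embedding X Y f \<longleftrightarrow>
     holomorphic_map X Y f \<and> immersive X Y f \<and> embedding_map (ctop X) (ctop Y) f"


section \<open>Projective space\<close>

text \<open>The points of \<open>\<P>\<^sup>N\<close> are the lines through the origin in \<open>\<complex>\<^bsup>N+1\<^esup>\<close>, with homogeneous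
  coordinates indexed by \<open>0, \<dots>, N\<close>.\<close>

definition cline :: "(nat \<Rightarrow> complex) \<Rightarrow> (nat \<Rightarrow> complex) set" where
  "cline z = range (\<lambda>a i. a * z i)"

definition punctured_complex_space :: "nat \<Rightarrow> (nat \<Rightarrow> complex) topology" where
  "punctured_complex_space n = subtopology (complex_space n) (- {\<lambda>_. 0})"

definition projective_top :: "nat \<Rightarrow> (nat \<Rightarrow> complex) set topology" where
  "projective_top N = topology (\<lambda>U. U \<subseteq> cline ` topspace (punctured_complex_space (Suc N)) \<and>
     openin (punctured_complex_space (Suc N))
       {z \<in> topspace (punctured_complex_space (Suc N)). cline z \<in> U})"

text \<open>Affine coordinates where the \<open>j\<close>-th homogeneous coordinate is nonzero: normalise it to 1 and
  leave it out.\<close>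

definition projective_chart :: "nat \<Rightarrow> nat \<Rightarrow> (nat \<Rightarrow> complex) set cchart" where
  "projective_chart N j =
     ({L \<in> topspace (projective_top N). \<exists>z\<in>L. z j \<noteq> 0},
      \<lambda>L i. if i < N then (THE z. z \<in> L \<and> z j = 1) (if i < j then i else Suc i) else 0)"

definition projective_space :: "nat \<Rightarrow> (nat \<Rightarrow> complex) set cmanifold" where
  "projective_space N = \<lparr>cdim = N, ctop = projective_top N, catlas = projective_chart N ` {..N}\<rparr>"

lemma openin_projective_top:
  "openin (projective_top N) U \<longleftrightarrow>
     U \<subseteq> cline ` topspace (punctured_complex_space (Suc N)) \<and>
     openin (punctured_complex_space (Suc N))
       {z \<in> topspace (punctured_complex_space (Suc N)). cline z \<in> U}"
proof -
  let ?Z = "punctured_complex_space (Suc N)"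
  have "istopology (\<lambda>U. U \<subseteq> cline ` topspace ?Z \<and> openin ?Z {z \<in> topspace ?Z. cline z \<in> U})"
    unfolding istopology_def
  proof (intro conjI allI impI)
    fix S T
    assume "S \<subseteq> cline ` topspace ?Z \<and> openin ?Z {z \<in> topspace ?Z. cline z \<in> S}"
      and "T \<subseteq> cline ` topspace ?Z \<and> openin ?Z {z \<in> topspace ?Z. cline z \<in> T}"
    moreover have "{z \<in> topspace ?Z. cline z \<in> S \<inter> T} =
        {z \<in> topspace ?Z. cline z \<in> S} \<inter> {z \<in> topspace ?Z. cline z \<in> T}"
      by auto
    ultimately show "S \<inter> T \<subseteq> cline ` topspace ?Z"
      and "openin ?Z {z \<in> topspace ?Z. cline z \<in> S \<inter> T}"
      by auto
  next
    fix \<K>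
    assume K: "\<forall>K\<in>\<K>. K \<subseteq> cline ` topspace ?Z \<and> openin ?Z {z \<in> topspace ?Z. cline z \<in> K}"
    then show "\<Union>\<K> \<subseteq> cline ` topspace ?Z" by blast
    have "{z \<in> topspace ?Z. cline z \<in> \<Union>\<K>} = \<Union>((\<lambda>K. {z \<in> topspace ?Z. cline z \<in> K}) ` \<K>)"
      by auto
    with K show "openin ?Z {z \<in> topspace ?Z. cline z \<in> \<Union>\<K>}"
      by (auto intro: openin_Union)
  qed
  then show ?thesis
    by (simp add: projective_top_def topology_inverse')
qed


section \<open>Holomorphic line bundles\<close>

text \<open>A line bundle is presented by its transition functions with respect to a trivialising open
  cover.\<close>

record ('i, 'a) line_bundle =
  lb_index :: "'i set"
  lb_dom :: "'i \<Rightarrow> 'a set"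
  lb_trans :: "'i \<Rightarrow> 'i \<Rightarrow> 'a \<Rightarrow> complex"

definition holomorphic_line_bundle :: "'a cmanifold \<Rightarrow> ('i, 'a) line_bundle \<Rightarrow> bool" where
  "holomorphic_line_bundle X E \<longleftrightarrow>
     (\<forall>\<alpha>\<in>lb_index E. openin (ctop X) (lb_dom E \<alpha>)) \<and>
     (\<Union>\<alpha>\<in>lb_index E. lb_dom E \<alpha>) = cpoints X \<and>
     (\<forall>\<alpha>\<in>lb_index E. \<forall>\<beta>\<in>lb_index E.
        holomorphic_fun_on X (lb_dom E \<alpha> \<inter> lb_dom E \<beta>) (lb_trans E \<alpha> \<beta>) \<and>
        (\<forall>x\<in>lb_dom E \<alpha> \<inter> lb_dom E \<beta>. lb_trans E \<alpha> \<beta> x \<noteq> 0)) \<and>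
     (\<forall>\<alpha>\<in>lb_index E. \<forall>\<beta>\<in>lb_index E. \<forall>\<gamma>\<in>lb_index E. \<forall>x\<in>lb_dom E \<alpha> \<inter> lb_dom E \<beta> \<inter> lb_dom E \<gamma>.
        lb_trans E \<alpha> \<beta> x * lb_trans E \<beta> \<gamma> x = lb_trans E \<alpha> \<gamma> x)"

text \<open>The one-dimensional case of the fact that transition maps of a tensor product are the tensor
  products of the transition maps.\<close>

definition tensor_power :: "('i, 'a) line_bundle \<Rightarrow> nat \<Rightarrow> ('i, 'a) line_bundle" where
  "tensor_power E k = E\<lparr>lb_trans := (\<lambda>\<alpha> \<beta> x. lb_trans E \<alpha> \<beta> x ^ k)\<rparr>"

text \<open>A section is given by its representatives in the trivialisations. The values of \<open>s \<alpha>\<close> outside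
  \<open>lb_dom E \<alpha>\<close>, and \<open>s \<alpha>\<close> for \<open>\<alpha>\<close> not in the index set, are irrelevant.\<close>

definition holomorphic_section ::
    "'a cmanifold \<Rightarrow> ('i, 'a) line_bundle \<Rightarrow> ('i \<Rightarrow> 'a \<Rightarrow> complex) \<Rightarrow> bool" where
  "holomorphic_section X E s \<longleftrightarrow>
     (\<forall>\<alpha>\<in>lb_index E. holomorphic_fun_on X (lb_dom E \<alpha>) (s \<alpha>)) \<and>
     (\<forall>\<alpha>\<in>lb_index E. \<forall>\<beta>\<in>lb_index E. \<forall>x\<in>lb_dom E \<alpha> \<inter> lb_dom E \<beta>.
        s \<alpha> x = lb_trans E \<alpha> \<beta> x * s \<beta> x)"

definition lb_index_at :: "('i, 'a) line_bundle \<Rightarrow> 'a \<Rightarrow> 'i" where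
  "lb_index_at E x = (SOME \<alpha>. \<alpha> \<in> lb_index E \<and> x \<in> lb_dom E \<alpha>)"

definition section_nonzero_at ::
    "('i, 'a) line_bundle \<Rightarrow> ('i \<Rightarrow> 'a \<Rightarrow> complex) \<Rightarrow> 'a \<Rightarrow> bool" where
  "section_nonzero_at E s x \<longleftrightarrow> s (lb_index_at E x) x \<noteq> 0"

text \<open>\<open>x \<mapsto> [s\<^sub>0(x) : \<dots> : s\<^sub>N(x)]\<close>, which does not depend on the trivialisation used at \<open>x\<close>.\<close>

definition linear_system_map ::
    "('i, 'a) line_bundle \<Rightarrow> nat \<Rightarrow> (nat \<Rightarrow> 'i \<Rightarrow> 'a \<Rightarrow> complex) \<Rightarrow> 'a \<Rightarrow> (nat \<Rightarrow> complex) set" where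
  "linear_system_map E N s x = cline (\<lambda>j. if j \<le> N then s j (lb_index_at E x) x else 0)"

definition very_ample :: "'a cmanifold \<Rightarrow> ('i, 'a) line_bundle \<Rightarrow> bool" where
  "very_ample X E \<longleftrightarrow>
     (\<exists>N s. (\<forall>j\<le>N. holomorphic_section X E (s j)) \<and>
        (\<forall>x\<in>cpoints X. \<exists>j\<le>N. section_nonzero_at E (s j) x) \<and>
        holomorphic_embedding X (projective_space N) (linear_system_map E N s))"

definition ample :: "'a cmanifold \<Rightarrow> ('i, 'a) line_bundle \<Rightarrow> bool" where
  "ample X E \<longleftrightarrow> (\<exists>m>0. very_ample X (tensor_power E m))"

definition polarised_manifold :: "'a cmanifold \<Rightarrow> ('i, 'a) line_bundle \<Rightarrow> bool" where
  "polarised_manifold X E \<longleftrightarrow>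
     complex_manifold X \<and> compact_space (ctop X) \<and> holomorphic_line_bundle X E \<and> ample X E"


section \<open>Divisors\<close>

text \<open>On a connected manifold this says that \<open>s\<close> is not identically zero. In general a section has
  a divisor only if it does not vanish identically on any connected component.\<close>

definition nontrivial_section ::
    "'a cmanifold \<Rightarrow> ('i, 'a) line_bundle \<Rightarrow> ('i \<Rightarrow> 'a \<Rightarrow> complex) \<Rightarrow> bool" where
  "nontrivial_section X E s \<longleftrightarrow>
     (\<forall>C\<in>connected_components_of (ctop X). \<exists>x\<in>C. section_nonzero_at E s x)"

text \<open>An effective (Cartier) divisor is represented by the set of all its local equations \<open>(U, f)\<close>,
  which in the case of the divisor of a section \<open>s\<close> are the \<open>f\<close> that differ from the local
  representatives of \<open>s\<close> by nowhere vanishing holomorphic factors. Multiplicities are thus retained.\<close>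

type_synonym 'a divisor = "('a set \<times> ('a \<Rightarrow> complex)) set"

definition divisor_of ::
    "'a cmanifold \<Rightarrow> ('i, 'a) line_bundle \<Rightarrow> ('i \<Rightarrow> 'a \<Rightarrow> complex) \<Rightarrow> 'a divisor" where
  "divisor_of X E s = {(U, f). openin (ctop X) U \<and> holomorphic_fun_on X U f \<and>
     (\<forall>\<alpha>\<in>lb_index E. \<exists>u. holomorphic_fun_on X (U \<inter> lb_dom E \<alpha>) u \<and>
        (\<forall>x\<in>U \<inter> lb_dom E \<alpha>. u x \<noteq> 0 \<and> f x = u x * s \<alpha> x))}"

definition divisor_support :: "'a divisor \<Rightarrow> 'a set" where
  "divisor_support D = {x. \<exists>(U, f)\<in>D. x \<in> U \<and> f x = 0}"

definition complete_linear_system :: "'a cmanifold \<Rightarrow> ('i, 'a) line_bundle \<Rightarrow> 'a divisor set" where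
  "complete_linear_system X E =
     {divisor_of X E s |s. holomorphic_section X E s \<and> nontrivial_section X E s}"

definition divisor_complement :: "'a cmanifold \<Rightarrow> 'a divisor \<Rightarrow> 'a cmanifold" where
  "divisor_complement X D = open_submanifold X (cpoints X - divisor_support D)"


section \<open>Stein manifolds\<close>

text \<open>The bound by every upper bound \<open>M\<close> of \<open>\<bar>f\<bar>\<close> on \<open>K\<close> is the bound by the supremum.\<close>

definition holomorphic_hull :: "'a cmanifold \<Rightarrow> 'a set \<Rightarrow> 'a set" where
  "holomorphic_hull Y K = {p\<in>cpoints Y. \<forall>f\<in>holomorphic_functions Y. \<forall>M.
     (\<forall>q\<in>K. cmod (f q) \<le> M) \<longrightarrow> cmod (f p) \<le> M}"

text \<open>Holomorphic functions separate points and provide local coordinates (their differentials span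
  the cotangent space at each point), and \<open>Y\<close> is holomorphically convex.\<close>

definition stein_manifold :: "'a cmanifold \<Rightarrow> bool" where
  "stein_manifold Y \<longleftrightarrow>
     complex_manifold Y \<and>
     (\<forall>p\<in>cpoints Y. \<forall>q\<in>cpoints Y. p \<noteq> q \<longrightarrow> (\<exists>f\<in>holomorphic_functions Y. f p \<noteq> f q)) \<and>
     (\<forall>p\<in>cpoints Y. \<forall>c\<in>catlas Y. p \<in> fst c \<longrightarrow>
        (\<exists>F :: nat \<Rightarrow> 'a \<Rightarrow> complex. (\<forall>i<cdim Y. F i \<in> holomorphic_functions Y) \<and>
           (\<forall>v :: nat \<Rightarrow> complex.
              (\<forall>i<cdim Y. (\<Sum>j<cdim Y. chart_pd c j (F i) p * v j) = 0) \<longrightarrow>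
              (\<forall>j<cdim Y. v j = 0)))) \<and>
     (\<forall>K. compactin (ctop Y) K \<longrightarrow> compactin (ctop Y) (holomorphic_hull Y K))"


section \<open>Holomorphic vector fields and the density property\<close>

text \<open>\<open>V c p i\<close> is the \<open>i\<close>-th component of the vector field \<open>V\<close> at the point \<open>p\<close> with respect to the
  chart \<open>c\<close>. Only its values for \<open>c\<close> in the atlas, \<open>p\<close> in the domain of \<open>c\<close> and \<open>i\<close> less than the
  dimension matter.\<close>

type_synonym 'a vfield = "'a cchart \<Rightarrow> 'a \<Rightarrow> nat \<Rightarrow> complex"

definition holomorphic_vfield :: "'a cmanifold \<Rightarrow> 'a vfield \<Rightarrow> bool" where
  "holomorphic_vfield Y V \<longleftrightarrow>
     (\<forall>c\<in>catlas Y. \<forall>i<cdim Y. holomorphic_fun_on Y (fst c) (\<lambda>p. V c p i)) \<and>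
     (\<forall>c\<in>catlas Y. \<forall>d\<in>catlas Y. \<forall>p\<in>fst c \<inter> fst d. \<forall>i<cdim Y.
        V d p i = (\<Sum>j<cdim Y. chart_pd c j (\<lambda>q. snd d q i) p * V c p j))"

definition vf_add :: "'a vfield \<Rightarrow> 'a vfield \<Rightarrow> 'a vfield" where
  "vf_add V W = (\<lambda>c p i. V c p i + W c p i)"

definition vf_commutator :: "'a cmanifold \<Rightarrow> 'a vfield \<Rightarrow> 'a vfield \<Rightarrow> 'a vfield" where
  "vf_commutator Y V W = (\<lambda>c p i. \<Sum>j<cdim Y.
     V c p j * chart_pd c j (\<lambda>q. W c q i) p - W c p j * chart_pd c j (\<lambda>q. V c q i) p)"

definition integral_curve :: "'a cmanifold \<Rightarrow> 'a vfield \<Rightarrow> (complex \<Rightarrow> 'a) \<Rightarrow> bool" where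
  "integral_curve Y V \<gamma> \<longleftrightarrow>
     continuous_map euclidean (ctop Y) \<gamma> \<and>
     (\<forall>t. \<forall>c\<in>catlas Y. \<gamma> t \<in> fst c \<longrightarrow> (\<forall>i<cdim Y.
        ((\<lambda>\<tau>. snd c (\<gamma> \<tau>) i) has_field_derivative V c (\<gamma> t) i) (at t)))"

definition complete_vfield :: "'a cmanifold \<Rightarrow> 'a vfield \<Rightarrow> bool" where
  "complete_vfield Y V \<longleftrightarrow>
     holomorphic_vfield Y V \<and>
     (\<forall>p\<in>cpoints Y. \<exists>\<gamma>. \<gamma> 0 = p \<and> integral_curve Y V \<gamma>)"

text \<open>The Lie algebra generated by the complete vector fields; scalar multiples of complete fields
  are complete.\<close>

inductive_set complete_combinations :: "'a cmanifold \<Rightarrow> 'a vfield set" for Y :: "'a cmanifold" where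
  complete: "complete_vfield Y V \<Longrightarrow> V \<in> complete_combinations Y"
| sum: "V \<in> complete_combinations Y \<Longrightarrow> W \<in> complete_combinations Y \<Longrightarrow>
    vf_add V W \<in> complete_combinations Y"
| commutator: "V \<in> complete_combinations Y \<Longrightarrow> W \<in> complete_combinations Y \<Longrightarrow>
    vf_commutator Y V W \<in> complete_combinations Y"

text \<open>Uniform approximation on compacts is measured in charts: every compact set is a finite union of
  compact sets \<open>L c\<close>, each contained in the domain of a chart \<open>c\<close>.\<close>

definition density_property :: "'a cmanifold \<Rightarrow> bool" where
  "density_property Y \<longleftrightarrow>
     (\<forall>V. holomorphic_vfield Y V \<longrightarrow>
        (\<forall>F L. \<forall>\<epsilon>>0. finite F \<and> F \<subseteq> catlas Y \<and> (\<forall>c\<in>F. compactin (ctop Y) (L c) \<and> L c \<subseteq> fst c) \<longrightarrow>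
           (\<exists>W\<in>complete_combinations Y.
              \<forall>c\<in>F. \<forall>p\<in>L c. \<forall>i<cdim Y. cmod (W c p i - V c p i) < \<epsilon>)))"

definition polarised_density_property :: "'a cmanifold \<Rightarrow> ('i, 'a) line_bundle \<Rightarrow> bool" where
  "polarised_density_property X E \<longleftrightarrow>
     (\<forall>x\<in>cpoints X. \<exists>D\<in>complete_linear_system X E.
        x \<in> cpoints (divisor_complement X D) \<and>
        stein_manifold (divisor_complement X D) \<and>
        density_property (divisor_complement X D))"

end

theory Submission
  imports Defs
begin

text \<open>If \<open>D\<close> is the divisor of a section \<open>s\<close> of \<open>E\<close>, then the divisor of \<open>s\<^sup>k\<close>, a section of the \<open>k\<close>-th
  power, has the same support, so the complements of the two divisors are the same manifold.
  Ampleness of the power reduces to the Veronese embedding: if \<open>s\<^sub>0, \<dots>, s\<^sub>N\<close> embed \<open>X\<close>, then so do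
  the products \<open>s\<^sub>i\<^bsup>k-1\<^esup> s\<^sub>j\<close>.\<close>

section \<open>Holomorphic functions\<close>

text \<open>The Veronese map is not built as a map between projective spaces that is then composed
  with the given embedding. The old and the new map are instead two instances of one construction,
  the map of a base-point-free linear system, so continuity and holomorphy are proved once for both.
  Injectivity, openness onto the image and immersivity remain; they are inherited because the old
  map can be recovered from the new one. Among all monomials of degree \<open>k\<close> the chosen
  products suffice: they include the powers \<open>s_i^k\<close>, which have no common zero, and
  they can be indexed by pairs instead of multi-indices.\<close>

lemma complex_space_eq: "complex_space n = top_of_set {z. \<forall>i\<ge>n. z i = 0}"
  by (simp add: complex_space_def euclidean_product_topology)

lemma topspace_complex_space [simp]: "topspace (complex_space n) = {z. \<forall>i\<ge>n. z i = 0}"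
  by (simp add: complex_space_eq)

lemma topspace_punctured_complex_space [simp]:
  "topspace (punctured_complex_space n) = {z. (\<forall>i\<ge>n. z i = 0) \<and> z \<noteq> (\<lambda>_. 0)}"
  by (auto simp: punctured_complex_space_def)

lemma continuous_map_into_complex_space:
  "continuous_map T (complex_space n) f \<longleftrightarrow>
     (\<forall>i. continuous_map T euclidean (\<lambda>x. f x i)) \<and> (\<forall>x\<in>topspace T. \<forall>i\<ge>n. f x i = 0)"
  by (auto simp: complex_space_def continuous_map_in_subtopology continuous_map_componentwise_UNIV Pi_iff)

lemma continuous_map_complex_space_nth:
  "continuous_map (complex_space n) euclidean (\<lambda>z. z i)"
  using continuous_map_into_complex_space[of "complex_space n" n id] by simp

lemma continuous_map_mult_complex:
  fixes f g :: "'a \<Rightarrow> complex"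
  assumes "continuous_map T euclidean f" "continuous_map T euclidean g"
  shows "continuous_map T euclidean (\<lambda>x. f x * g x)"
  using assms by (simp add: continuous_map_atin tendsto_mult)

lemma continuous_map_divide_complex:
  fixes f g :: "'a \<Rightarrow> complex"
  assumes "continuous_map T euclidean f" "continuous_map T euclidean g"
    and "\<And>x. x \<in> topspace T \<Longrightarrow> g x \<noteq> 0"
  shows "continuous_map T euclidean (\<lambda>x. f x / g x)"
  using assms by (simp add: continuous_map_atin tendsto_divide)

text \<open>The local formula \<open>g\<close> may change from point to point, as a chart or
  trivialisation chosen there does; all of them agree with \<open>f\<close>, so they can be
  pasted.\<close>

lemma continuous_map_locally:
  assumes "\<And>x. x \<in> topspace T \<Longrightarrow>
    \<exists>U g. openin T U \<and> x \<in> U \<and> continuous_map (subtopology T U) Y g \<and> (\<forall>y\<in>U. f y = g y)"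
  shows "continuous_map T Y f"
proof -
  obtain U g where Ug: "\<And>x. x \<in> topspace T \<Longrightarrow> openin T (U x) \<and> x \<in> U x \<and>
      continuous_map (subtopology T (U x)) Y (g x) \<and> (\<forall>y\<in>U x. f y = g x y)"
    using assms by metis
  show ?thesis
    by (rule pasting_lemma[where I = "topspace T" and T = U and f = g])
      (use Ug in simp_all, (metis Int_iff Ug)+)
qed

text \<open>Changing a coordinate below \<open>n\<close> stays inside
  \<open>complex_space n\<close>, so a coordinate line through a point of \<open>T\<close> remains
  in \<open>T\<close> for a while. Hence partial derivatives depend only on values in
  \<open>T\<close>.\<close>

lemma eventually_fun_upd_in_openin:
  assumes "openin (complex_space n) T" "z \<in> T" "i < n"
  shows "\<forall>\<^sub>F t in nhds (z i). z(i := t) \<in> T"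
proof -
  obtain O' where O': "open O'" "T = {z. \<forall>i\<ge>n. z i = 0} \<inter> O'"
    using assms(1) by (auto simp: complex_space_eq openin_open)
  have "continuous_on UNIV (\<lambda>t. z(i := t))"
  proof (rule continuous_on_coordinatewise_then_product)
    show "continuous_on UNIV (\<lambda>t. (z(i := t)) j)" for j
      by (cases "j = i") auto
  qed
  then have "open ((\<lambda>t. z(i := t)) -` O')"
    using O'(1) by (simp add: open_vimage)
  moreover have "z i \<in> (\<lambda>t. z(i := t)) -` O'"
    using assms(2) O'(2) by simp
  ultimately have "\<forall>\<^sub>F t in nhds (z i). t \<in> (\<lambda>t. z(i := t)) -` O'"
    by (simp add: eventually_nhds) blast
  then show ?thesis
    by eventually_elim (use assms O'(2) in auto)
qed

lemma holomorphic_Cn_mult: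
  assumes "holomorphic_Cn n S f" "holomorphic_Cn n S g"
  shows "holomorphic_Cn n S (\<lambda>z. f z * g z)"
  using assms unfolding holomorphic_Cn_def
  by (auto intro: continuous_map_mult_complex field_differentiable_mult)

lemma holomorphic_Cn_const: "holomorphic_Cn n S (\<lambda>z. c)"
  unfolding holomorphic_Cn_def by auto

lemma holomorphic_Cn_power:
  assumes "holomorphic_Cn n S f"
  shows "holomorphic_Cn n S (\<lambda>z. f z ^ k)"
  by (induction k) (auto intro: holomorphic_Cn_mult holomorphic_Cn_const assms)

lemma holomorphic_Cn_divide:
  assumes "holomorphic_Cn n S f" "holomorphic_Cn n S g" "\<And>z. z \<in> S \<Longrightarrow> g z \<noteq> 0"
  shows "holomorphic_Cn n S (\<lambda>z. f z / g z)"
  using assms unfolding holomorphic_Cn_def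
  by (auto intro!: continuous_map_divide_complex field_differentiable_divide)

lemma holomorphic_Cn_subset:
  assumes "holomorphic_Cn n S f" "T \<subseteq> S"
  shows "holomorphic_Cn n T f"
  using assms unfolding holomorphic_Cn_def
  by (auto intro: continuous_map_from_subtopology_mono)

text \<open>Each \<open>T\<close> is open in the whole of \<open>complex_space n\<close>, not just
  relative to \<open>S\<close>: derivatives along coordinate lines must see a full
  neighbourhood.\<close>

lemma holomorphic_Cn_locally:
  assumes "\<And>z. z \<in> S \<Longrightarrow>
    \<exists>T g. openin (complex_space n) T \<and> z \<in> T \<and> T \<subseteq> S \<and> holomorphic_Cn n T g \<and> (\<forall>w\<in>T. f w = g w)"
  shows "holomorphic_Cn n S f"
  unfolding holomorphic_Cn_def
proof (intro conjI ballI allI impI)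
  show "continuous_map (subtopology (complex_space n) S) euclidean f"
  proof (rule continuous_map_locally)
    fix z assume "z \<in> topspace (subtopology (complex_space n) S)"
    then have "z \<in> S" by simp
    then obtain T g where T: "openin (complex_space n) T" "z \<in> T" "T \<subseteq> S" "holomorphic_Cn n T g"
        "\<forall>w\<in>T. f w = g w"
      using assms by blast
    moreover have "openin (subtopology (complex_space n) S) T"
      using T by (metis inf.absorb2 openin_subtopology_Int2)
    moreover have "continuous_map (subtopology (subtopology (complex_space n) S) T) euclidean g"
      using T by (simp add: subtopology_subtopology holomorphic_Cn_def inf.absorb2)
    ultimately show "\<exists>U g. openin (subtopology (complex_space n) S) U \<and> z \<in> U \<and>
        continuous_map (subtopology (subtopology (complex_space n) S) U) euclidean g \<and>
        (\<forall>y\<in>U. f y = g y)"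
      by blast
  qed
next
  fix z i assume "z \<in> S" "i < n"
  then obtain T g where T: "openin (complex_space n) T" "z \<in> T" "T \<subseteq> S" "holomorphic_Cn n T g"
      "\<forall>w\<in>T. f w = g w"
    using assms by blast
  have "\<forall>\<^sub>F t in nhds (z i). f (z(i := t)) = g (z(i := t))"
    using eventually_fun_upd_in_openin[OF T(1,2) \<open>i < n\<close>] by eventually_elim (use T(5) in auto)
  moreover have "(\<lambda>t. g (z(i := t))) field_differentiable at (z i)"
    using T \<open>i < n\<close> by (auto simp: holomorphic_Cn_def)
  ultimately show "(\<lambda>t. f (z(i := t))) field_differentiable at (z i)"
    unfolding field_differentiable_def
    by (subst has_field_derivative_cong_ev[OF refl _ refl refl, where g = "\<lambda>t. g (z(i := t))"])
      (auto elim: eventually_mono)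
qed


section \<open>Functions on complex manifolds\<close>

lemma chart_open:
  assumes "complex_manifold X" "(U, \<phi>) \<in> catlas X"
  shows "openin (ctop X) U" "U \<subseteq> cpoints X"
  using assms by (auto simp: complex_manifold_def dest: openin_subset)

lemma chart_homeo:
  assumes "complex_manifold X" "(U, \<phi>) \<in> catlas X"
  shows "openin (complex_space (cdim X)) (\<phi> ` U)"
    and "homeomorphic_map (subtopology (ctop X) U) (subtopology (complex_space (cdim X)) (\<phi> ` U)) \<phi>"
  using assms by (auto simp: complex_manifold_def)

lemma chart_inj:
  assumes "complex_manifold X" "(U, \<phi>) \<in> catlas X"
  shows "inj_on \<phi> U"
  using homeomorphic_imp_injective_map[OF chart_homeo(2)[OF assms]] chart_open[OF assms]
  by (simp add: inf.absorb2)

lemma openin_chart_image: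
  assumes "complex_manifold X" "(U, \<phi>) \<in> catlas X" "openin (ctop X) W"
  shows "openin (complex_space (cdim X)) (\<phi> ` (U \<inter> W))"
proof -
  have "openin (subtopology (ctop X) U) (U \<inter> W)"
    using assms(3) by (simp add: openin_subtopology_Int2)
  then have "openin (subtopology (complex_space (cdim X)) (\<phi> ` U)) (\<phi> ` (U \<inter> W))"
    using homeomorphic_imp_open_map[OF chart_homeo(2)[OF assms(1,2)]] by (simp add: open_map_def)
  then show ?thesis
    using chart_homeo(1)[OF assms(1,2)] openin_trans_full by blast
qed

lemma holomorphic_fun_on_mult:
  "\<lbrakk>holomorphic_fun_on X W f; holomorphic_fun_on X W g\<rbrakk> \<Longrightarrow> holomorphic_fun_on X W (\<lambda>x. f x * g x)"
  unfolding holomorphic_fun_on_def by (auto intro: holomorphic_Cn_mult)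

lemma holomorphic_fun_on_power:
  "holomorphic_fun_on X W f \<Longrightarrow> holomorphic_fun_on X W (\<lambda>x. f x ^ k)"
  unfolding holomorphic_fun_on_def by (auto intro: holomorphic_Cn_power)

text \<open>Holomorphy is stated in coordinates only. On each chart domain \<open>f\<close> is its
  coordinate expression composed with the chart, which carries continuity back to the
  manifold.\<close>

lemma holomorphic_fun_on_imp_continuous:
  assumes X: "complex_manifold X" and W: "openin (ctop X) W" and f: "holomorphic_fun_on X W f"
  shows "continuous_map (subtopology (ctop X) W) euclidean f"
proof (rule continuous_map_locally)
  fix x assume "x \<in> topspace (subtopology (ctop X) W)"
  then have x: "x \<in> cpoints X" "x \<in> W" by auto
  then obtain U \<phi> where c: "(U, \<phi>) \<in> catlas X" and "x \<in> U"
    using X by (force simp: complex_manifold_def)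
  have eq: "subtopology (subtopology (ctop X) W) (U \<inter> W) = subtopology (ctop X) (U \<inter> W)"
    by (simp add: subtopology_subtopology inf.absorb2)
  have "continuous_map (subtopology (ctop X) U) (complex_space (cdim X)) \<phi>"
    using chart_homeo(2)[OF X c]
    by (meson continuous_map_in_subtopology homeomorphic_imp_continuous_map)
  then have "continuous_map (subtopology (ctop X) (U \<inter> W)) (subtopology (complex_space (cdim X)) (\<phi> ` (U \<inter> W))) \<phi>"
    by (auto simp: continuous_map_in_subtopology elim: continuous_map_from_subtopology_mono)
  moreover have "continuous_map (subtopology (complex_space (cdim X)) (\<phi> ` (U \<inter> W))) euclidean
      (\<lambda>z. f (inv_into U \<phi> z))"
    using f c by (auto simp: holomorphic_fun_on_def holomorphic_Cn_def)
  ultimately have "continuous_map (subtopology (ctop X) (U \<inter> W)) euclidean ((\<lambda>z. f (inv_into U \<phi> z)) \<circ> \<phi>)"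
    by (rule continuous_map_compose)
  moreover have "\<forall>y\<in>U \<inter> W. f y = ((\<lambda>z. f (inv_into U \<phi> z)) \<circ> \<phi>) y"
    using chart_inj[OF X c] by simp
  moreover have "openin (subtopology (ctop X) W) (U \<inter> W)"
    using chart_open[OF X c] by (metis inf_commute openin_subtopology_Int)
  ultimately show "\<exists>V g. openin (subtopology (ctop X) W) V \<and> x \<in> V \<and>
      continuous_map (subtopology (subtopology (ctop X) W) V) euclidean g \<and> (\<forall>y\<in>V. f y = g y)"
    using \<open>x \<in> U\<close> x(2) eq by (metis IntI)
qed

lemma openin_nonzero_holomorphic:
  assumes "complex_manifold X" "openin (ctop X) W" "holomorphic_fun_on X W f"
  shows "openin (ctop X) {x\<in>W. f x \<noteq> 0}"
proof -
  have "openin (subtopology (ctop X) W) {x \<in> topspace (subtopology (ctop X) W). f x \<in> - {0}}"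
    by (rule openin_continuous_map_preimage[OF holomorphic_fun_on_imp_continuous[OF assms]]) auto
  moreover have "{x \<in> topspace (subtopology (ctop X) W). f x \<in> - {0}} = {x\<in>W. f x \<noteq> 0}"
    using openin_subset[OF assms(2)] by auto
  ultimately show ?thesis
    using assms(2) openin_trans_full by metis
qed

text \<open>A partial derivative depends only on the germ at \<open>p\<close>. This later allows a
  coordinate of one projective map to be replaced by a coordinate of another that agrees with it
  near \<open>p\<close> only.\<close>

lemma chart_pd_cong:
  assumes "complex_manifold X" "c \<in> catlas X" "p \<in> fst c" "openin (ctop X) W" "p \<in> W"
    and "\<And>q. q \<in> W \<Longrightarrow> f q = g q" and "j < cdim X"
  shows "chart_pd c j f p = chart_pd c j g p"
proof -
  obtain U \<phi> where c: "c = (U, \<phi>)" by force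
  have "\<forall>\<^sub>F t in nhds (\<phi> p j). (\<phi> p)(j := t) \<in> \<phi> ` (U \<inter> W)"
    using assms c by (intro eventually_fun_upd_in_openin[OF openin_chart_image]) auto
  then have "\<forall>\<^sub>F t in nhds (\<phi> p j). f (inv_into U \<phi> ((\<phi> p)(j := t))) = g (inv_into U \<phi> ((\<phi> p)(j := t)))"
    by eventually_elim (use assms(1,2,6) c chart_inj in fastforce)
  then show ?thesis
    unfolding chart_pd_def c by (auto intro: deriv_cong_ev)
qed


section \<open>Projective space\<close>

lemma topspace_projective_top:
  "topspace (projective_top N) = cline ` topspace (punctured_complex_space (Suc N))"
proof -
  have "openin (projective_top N) (cline ` topspace (punctured_complex_space (Suc N)))"
    unfolding openin_projective_top
    by (metis (no_types, lifting) Collect_cong image_eqI openin_topspace subset_refl Collect_mem_eq)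
  then show ?thesis
    by (metis openin_projective_top openin_subset openin_topspace subset_antisym)
qed

lemma continuous_map_cline:
  "continuous_map (punctured_complex_space (Suc N)) (projective_top N) cline"
  unfolding continuous_map_def using openin_projective_top topspace_projective_top by fastforce

lemma cline_self: "z \<in> cline z"
  unfolding cline_def by (rule range_eqI[of _ _ 1]) auto

lemma cline_scale:
  assumes "a \<noteq> 0"
  shows "cline (\<lambda>i. a * z i) = cline z"
proof -
  have "(\<lambda>i. b * z i) \<in> cline (\<lambda>i. a * z i)" for b
    using assms unfolding cline_def by (auto intro!: range_eqI[of _ _ "b / a"])
  moreover have "(\<lambda>i. b * (a * z i)) \<in> cline z" for b
    unfolding cline_def by (auto intro!: range_eqI[of _ _ "b * a"])
  ultimately show ?thesis
    by (auto simp: cline_def)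
qed

lemma cline_eqD:
  assumes "cline w = cline z"
  obtains a where "w = (\<lambda>i. a * z i)"
  using assms cline_self[of w] by (auto simp: cline_def)

lemma projective_chart_domain:
  assumes "z \<in> topspace (punctured_complex_space (Suc N))"
  shows "cline z \<in> fst (projective_chart N j) \<longleftrightarrow> z j \<noteq> 0"
  using assms cline_self[of z] by (auto simp: projective_chart_def topspace_projective_top cline_def)

text \<open>The unique point of the line with \<open>j\<close>-th coordinate 1 is \<open>z\<close>
  divided by \<open>z j\<close>, which evaluates the definite description in the chart.\<close>

lemma projective_chart_cline:
  assumes "z j \<noteq> 0"
  shows "snd (projective_chart N j) (cline z) i =
    (if i < N then z (if i < j then i else Suc i) / z j else 0)"
proof -
  have "(THE w. w \<in> cline z \<and> w j = 1) = (\<lambda>i. z i / z j)"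
  proof (rule the_equality)
    show "(\<lambda>i. z i / z j) \<in> cline z \<and> z j / z j = 1"
      using assms unfolding cline_def by (auto intro!: range_eqI[of _ _ "1 / z j"])
    show "w = (\<lambda>i. z i / z j)" if "w \<in> cline z \<and> w j = 1" for w
      using that assms by (auto simp: cline_def field_simps)
  qed
  then show ?thesis
    by (simp add: projective_chart_def)
qed

lemma projective_space_sel [simp]:
  "cdim (projective_space N) = N" "ctop (projective_space N) = projective_top N"
  "catlas (projective_space N) = projective_chart N ` {..N}"
  by (simp_all add: projective_space_def)

text \<open>The origin is a closed point. Openness can thus be tested in the unpunctured space,
  where linear projections are defined everywhere.\<close>

lemma openin_punctured_complex_space:
  "openin (punctured_complex_space n) A \<longleftrightarrow> openin (complex_space n) A \<and> (\<lambda>_. 0) \<notin> A"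
proof
  assume "openin (punctured_complex_space n) A"
  then obtain T where "openin (complex_space n) T" "A = T \<inter> - {\<lambda>_. 0}"
    by (auto simp: punctured_complex_space_def openin_subtopology)
  then obtain O' where "open O'" "A = {z. \<forall>i\<ge>n. z i = 0} \<inter> (O' \<inter> - {\<lambda>_. 0})"
    by (auto simp: complex_space_eq openin_open)
  moreover from \<open>open O'\<close> have "open (O' \<inter> - {\<lambda>_. 0})"
    by auto
  ultimately show "openin (complex_space n) A \<and> (\<lambda>_. 0) \<notin> A"
    unfolding complex_space_eq openin_open by blast
next
  assume "openin (complex_space n) A \<and> (\<lambda>_. 0) \<notin> A"
  then show "openin (punctured_complex_space n) A"
    unfolding punctured_complex_space_def openin_subtopology by blast
qed


section \<open>Maps given by linear systems\<close>

lemma lb_index_at_tensor_power [simp]: "lb_index_at (tensor_power E k) = lb_index_at E"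
  by (simp add: fun_eq_iff lb_index_at_def tensor_power_def)

lemma tensor_power_sel [simp]:
  "lb_index (tensor_power E k) = lb_index E" "lb_dom (tensor_power E k) = lb_dom E"
  "lb_trans (tensor_power E k) \<alpha> \<beta> x = lb_trans E \<alpha> \<beta> x ^ k"
  by (simp_all add: tensor_power_def)

lemma section_nonzero_at_tensor_power [simp]:
  "section_nonzero_at (tensor_power E k) = section_nonzero_at E"
  by (simp add: fun_eq_iff section_nonzero_at_def)

lemma tensor_power_tensor_power:
  "tensor_power (tensor_power E k) m = tensor_power (tensor_power E m) k"
  by (simp add: tensor_power_def mult.commute flip: power_mult)

lemma holomorphic_line_bundle_tensor_power:
  assumes "holomorphic_line_bundle X E"
  shows "holomorphic_line_bundle X (tensor_power E k)"
proof -
  have "lb_trans E \<alpha> \<beta> x ^ k * lb_trans E \<beta> \<gamma> x ^ k = lb_trans E \<alpha> \<gamma> x ^ k"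
    if "\<alpha> \<in> lb_index E" "\<beta> \<in> lb_index E" "\<gamma> \<in> lb_index E"
      "x \<in> lb_dom E \<alpha>" "x \<in> lb_dom E \<beta>" "x \<in> lb_dom E \<gamma>" for \<alpha> \<beta> \<gamma> x
    using assms that unfolding holomorphic_line_bundle_def
    by (metis IntI power_mult_distrib)
  then show ?thesis
    using assms unfolding holomorphic_line_bundle_def
    by (auto simp: tensor_power_def intro!: holomorphic_fun_on_power)
qed

lemma lb_index_at:
  assumes "holomorphic_line_bundle X E" "x \<in> cpoints X"
  shows "lb_index_at E x \<in> lb_index E" "x \<in> lb_dom E (lb_index_at E x)"
proof -
  have "\<exists>\<alpha>. \<alpha> \<in> lb_index E \<and> x \<in> lb_dom E \<alpha>"
    using assms unfolding holomorphic_line_bundle_def by blast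
  from someI_ex[OF this] show "lb_index_at E x \<in> lb_index E" "x \<in> lb_dom E (lb_index_at E x)"
    unfolding lb_index_at_def by blast+
qed

lemma lb_dom_open:
  assumes "holomorphic_line_bundle X E" "\<alpha> \<in> lb_index E"
  shows "openin (ctop X) (lb_dom E \<alpha>)" "lb_dom E \<alpha> \<subseteq> cpoints X"
  using assms unfolding holomorphic_line_bundle_def by (auto dest: openin_subset)

lemma lb_trans_nonzero:
  assumes "holomorphic_line_bundle X E" "\<alpha> \<in> lb_index E" "\<beta> \<in> lb_index E"
    "x \<in> lb_dom E \<alpha>" "x \<in> lb_dom E \<beta>"
  shows "lb_trans E \<alpha> \<beta> x \<noteq> 0"
  using assms unfolding holomorphic_line_bundle_def by blast

lemma section_transform:
  assumes "holomorphic_section X E s" "\<alpha> \<in> lb_index E" "\<beta> \<in> lb_index E"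
    "x \<in> lb_dom E \<alpha>" "x \<in> lb_dom E \<beta>"
  shows "s \<alpha> x = lb_trans E \<alpha> \<beta> x * s \<beta> x"
  using assms unfolding holomorphic_section_def by blast

lemma section_nonzero_at_iff:
  assumes "holomorphic_line_bundle X E" "holomorphic_section X E s"
    "\<alpha> \<in> lb_index E" "x \<in> lb_dom E \<alpha>"
  shows "section_nonzero_at E s x \<longleftrightarrow> s \<alpha> x \<noteq> 0"
proof -
  have x: "x \<in> cpoints X"
    using lb_dom_open(2)[OF assms(1,3)] assms(4) by blast
  show ?thesis
    unfolding section_nonzero_at_def
    using section_transform[OF assms(2,3) lb_index_at(1)[OF assms(1) x] assms(4) lb_index_at(2)[OF assms(1) x]]
      lb_trans_nonzero[OF assms(1,3) lb_index_at(1)[OF assms(1) x] assms(4) lb_index_at(2)[OF assms(1) x]]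
    by simp
qed

text \<open>A base-point-free linear system, with no embedding assumed, so that the original
  sections and their Veronese products are both instances.\<close>

locale linear_system =
  fixes X :: "'a cmanifold" and E :: "('i, 'a) line_bundle"
    and N :: nat and s :: "nat \<Rightarrow> 'i \<Rightarrow> 'a \<Rightarrow> complex"
  assumes manifold: "complex_manifold X"
    and lb: "holomorphic_line_bundle X E"
    and sections: "\<And>j. j \<le> N \<Longrightarrow> holomorphic_section X E (s j)"
    and base_point_free: "\<And>x. x \<in> cpoints X \<Longrightarrow> \<exists>j\<le>N. section_nonzero_at E (s j) x"
begin

text \<open>A lift of the map to the punctured space over one trivialisation; the zeros beyond
  \<open>N\<close> make it a point of \<open>complex_space (Suc N)\<close>.\<close>

definition tuple :: "'i \<Rightarrow> 'a \<Rightarrow> nat \<Rightarrow> complex" where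
  "tuple \<alpha> x = (\<lambda>j. if j \<le> N then s j \<alpha> x else 0)"

abbreviation lsmap :: "'a \<Rightarrow> (nat \<Rightarrow> complex) set" where
  "lsmap \<equiv> linear_system_map E N s"

lemma tuple_nonzero:
  assumes "\<alpha> \<in> lb_index E" "x \<in> lb_dom E \<alpha>"
  obtains j where "j \<le> N" "s j \<alpha> x \<noteq> 0"
proof -
  have "x \<in> cpoints X"
    using lb_dom_open[OF lb] assms by blast
  then show ?thesis
    using base_point_free section_nonzero_at_iff[OF lb sections assms] that by blast
qed

lemma tuple_punctured:
  assumes "\<alpha> \<in> lb_index E" "x \<in> lb_dom E \<alpha>"
  shows "tuple \<alpha> x \<in> topspace (punctured_complex_space (Suc N))"
proof -
  obtain j where "j \<le> N" "s j \<alpha> x \<noteq> 0"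
    using tuple_nonzero[OF assms] .
  then show ?thesis
    by (auto simp: tuple_def fun_eq_iff)
qed

text \<open>A change of trivialisation multiplies the whole tuple by a nonvanishing transition
  function, which does not move the line.\<close>

lemma lsmap_eq:
  assumes "\<alpha> \<in> lb_index E" "x \<in> lb_dom E \<alpha>"
  shows "lsmap x = cline (tuple \<alpha> x)"
proof -
  define \<beta> where "\<beta> = lb_index_at E x"
  have "x \<in> cpoints X"
    using lb_dom_open[OF lb] assms by blast
  then have \<beta>: "\<beta> \<in> lb_index E" "x \<in> lb_dom E \<beta>"
    using lb_index_at[OF lb] by (auto simp: \<beta>_def)
  have "tuple \<beta> x = (\<lambda>j. lb_trans E \<beta> \<alpha> x * tuple \<alpha> x j)"
    using section_transform[OF sections \<beta>(1) assms(1) \<beta>(2) assms(2)]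
    by (auto simp: tuple_def fun_eq_iff)
  then have "cline (tuple \<beta> x) = cline (tuple \<alpha> x)"
    using lb_trans_nonzero[OF lb \<beta>(1) assms(1) \<beta>(2) assms(2)] by (simp add: cline_scale)
  then show ?thesis
    by (simp add: linear_system_map_def tuple_def \<beta>_def)
qed

lemma lsmap_in_chart_iff:
  assumes "\<alpha> \<in> lb_index E" "x \<in> lb_dom E \<alpha>" "j \<le> N"
  shows "lsmap x \<in> fst (projective_chart N j) \<longleftrightarrow> s j \<alpha> x \<noteq> 0"
  using projective_chart_domain[OF tuple_punctured[OF assms(1,2)]] assms
  by (simp add: lsmap_eq tuple_def)

lemma lsmap_coordinate:
  assumes "\<alpha> \<in> lb_index E" "x \<in> lb_dom E \<alpha>" "j \<le> N" "s j \<alpha> x \<noteq> 0" "i < N"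
  shows "snd (projective_chart N j) (lsmap x) i = s (if i < j then i else Suc i) \<alpha> x / s j \<alpha> x"
  using projective_chart_cline[of "tuple \<alpha> x" j N i] assms
  by (simp add: lsmap_eq[OF assms(1,2)] tuple_def)

lemma holomorphic_representative:
  assumes "\<alpha> \<in> lb_index E" "j \<le> N"
  shows "holomorphic_fun_on X (lb_dom E \<alpha>) (s j \<alpha>)"
  using sections[OF assms(2)] assms(1) unfolding holomorphic_section_def by blast

lemma openin_nonzero_representative:
  assumes "\<alpha> \<in> lb_index E" "j \<le> N"
  shows "openin (ctop X) {x \<in> lb_dom E \<alpha>. s j \<alpha> x \<noteq> 0}"
  by (rule openin_nonzero_holomorphic[OF manifold lb_dom_open(1)[OF lb assms(1)]
        holomorphic_representative[OF assms]])

lemma continuous_lsmap: "continuous_map (ctop X) (projective_top N) lsmap"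
proof (rule continuous_map_locally)
  fix x assume x: "x \<in> cpoints X"
  \<comment> \<open>\<open>linear_system_map\<close> picks a trivialisation at every point
    separately, with no continuity in the point. Freezing the choice made at \<open>x\<close> gives
    a continuous lift on a neighbourhood.\<close>
  define \<alpha> where "\<alpha> = lb_index_at E x"
  have \<alpha>: "\<alpha> \<in> lb_index E" "x \<in> lb_dom E \<alpha>"
    using lb_index_at[OF lb x] by (auto simp: \<alpha>_def)
  have "continuous_map (subtopology (ctop X) (lb_dom E \<alpha>)) euclidean (\<lambda>y. tuple \<alpha> y j)" for j
    using holomorphic_fun_on_imp_continuous[OF manifold lb_dom_open(1)[OF lb \<alpha>(1)]
        holomorphic_representative[OF \<alpha>(1)], of j]
    by (cases "j \<le> N") (auto simp: tuple_def)
  then have "continuous_map (subtopology (ctop X) (lb_dom E \<alpha>)) (punctured_complex_space (Suc N)) (tuple \<alpha>)"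
    unfolding punctured_complex_space_def continuous_map_in_subtopology continuous_map_into_complex_space
    using tuple_punctured[OF \<alpha>(1)] by (auto simp: tuple_def)
  then have "continuous_map (subtopology (ctop X) (lb_dom E \<alpha>)) (projective_top N) (cline \<circ> tuple \<alpha>)"
    by (rule continuous_map_compose[OF _ continuous_map_cline])
  moreover have "\<forall>y\<in>lb_dom E \<alpha>. lsmap y = (cline \<circ> tuple \<alpha>) y"
    using lsmap_eq[OF \<alpha>(1)] by simp
  ultimately show "\<exists>U g. openin (ctop X) U \<and> x \<in> U \<and>
      continuous_map (subtopology (ctop X) U) (projective_top N) g \<and> (\<forall>y\<in>U. lsmap y = g y)"
    using \<alpha> lb_dom_open(1)[OF lb] by blast
qed

text \<open>In a fixed trivialisation the affine coordinates are quotients of representatives of two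
  sections, and the denominator is nonzero exactly where the image lies in the affine chart.\<close>

lemma holomorphic_lsmap: "holomorphic_map X (projective_space N) lsmap"
proof -
  have "holomorphic_Cn (cdim X) (\<phi> ` {p\<in>U. lsmap p \<in> V}) (\<lambda>z. \<psi> (lsmap (inv_into U \<phi> z)) i)"
    if c: "(U, \<phi>) \<in> catlas X" and j: "(V, \<psi>) = projective_chart N j" "j \<le> N" and i: "i < N"
    for U \<phi> V \<psi> j i
  proof (rule holomorphic_Cn_locally)
    fix z assume "z \<in> \<phi> ` {p\<in>U. lsmap p \<in> V}"
    then obtain p where p: "p \<in> U" "lsmap p \<in> V" "z = \<phi> p" by auto
    define \<alpha> where "\<alpha> = lb_index_at E p"
    have \<alpha>: "\<alpha> \<in> lb_index E" "p \<in> lb_dom E \<alpha>"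
      using lb_index_at[OF lb] p(1) chart_open(2)[OF manifold c] by (auto simp: \<alpha>_def)
    define W where "W = {x \<in> lb_dom E \<alpha>. s j \<alpha> x \<noteq> 0}"
    have V: "V = fst (projective_chart N j)" and \<psi>: "\<psi> = snd (projective_chart N j)"
      by (simp_all flip: j(1))
    have W: "x \<in> W \<longleftrightarrow> lsmap x \<in> V" if "x \<in> lb_dom E \<alpha>" for x
      using lsmap_in_chart_iff[OF \<alpha>(1) that j(2)] that by (simp add: W_def V)
    define g where "g = (\<lambda>x. s (if i < j then i else Suc i) \<alpha> x / s j \<alpha> x)"
    have inv: "inv_into U \<phi> w \<in> U \<inter> W" if "w \<in> \<phi> ` (U \<inter> W)" for w
      using that chart_inj[OF manifold c] by auto
    have rep: "holomorphic_Cn (cdim X) (\<phi> ` (U \<inter> W)) (\<lambda>w. s l \<alpha> (inv_into U \<phi> w))" if "l \<le> N" for l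
      using holomorphic_representative[OF \<alpha>(1) that] c unfolding holomorphic_fun_on_def W_def
      by (auto elim!: holomorphic_Cn_subset)
    have "holomorphic_Cn (cdim X) (\<phi> ` (U \<inter> W)) (\<lambda>w. g (inv_into U \<phi> w))"
      unfolding g_def
    proof (rule holomorphic_Cn_divide)
      show "s j \<alpha> (inv_into U \<phi> w) \<noteq> 0" if "w \<in> \<phi> ` (U \<inter> W)" for w
        using inv[OF that] by (simp add: W_def)
    qed (use i j in \<open>auto intro: rep\<close>)
    moreover have "\<forall>w\<in>\<phi> ` (U \<inter> W). \<psi> (lsmap (inv_into U \<phi> w)) i = g (inv_into U \<phi> w)"
    proof
      fix w assume "w \<in> \<phi> ` (U \<inter> W)"
      from inv[OF this] show "\<psi> (lsmap (inv_into U \<phi> w)) i = g (inv_into U \<phi> w)"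
        unfolding g_def \<psi> using lsmap_coordinate[OF \<alpha>(1) _ j(2) _ i] by (simp add: W_def)
    qed
    moreover have "openin (complex_space (cdim X)) (\<phi> ` (U \<inter> W))"
      using openin_chart_image[OF manifold c] openin_nonzero_representative[OF \<alpha>(1) j(2)]
      by (simp add: W_def)
    moreover have "z \<in> \<phi> ` (U \<inter> W)" "\<phi> ` (U \<inter> W) \<subseteq> \<phi> ` {p\<in>U. lsmap p \<in> V}"
      using p \<alpha> W by (auto simp: W_def)
    ultimately show "\<exists>T g. openin (complex_space (cdim X)) T \<and> z \<in> T \<and> T \<subseteq> \<phi> ` {p\<in>U. lsmap p \<in> V} \<and>
        holomorphic_Cn (cdim X) T g \<and> (\<forall>w\<in>T. \<psi> (lsmap (inv_into U \<phi> w)) i = g w)"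
      by blast
  qed
  then show ?thesis
    unfolding holomorphic_map_def using continuous_lsmap by fastforce
qed

end

section \<open>Veronese embeddings\<close>

text \<open>The products \<open>s\<^sub>i\<^bsup>k-1\<^esup> s\<^sub>j\<close>, with the pair \<open>(i, j)\<close>, \<open>i, j \<le> N\<close>, encoded as the index
  \<open>i (N+1) + j\<close>. For fixed \<open>i\<close> they are the tuple \<open>(s\<^sub>j)\<^sub>j\<close> scaled by a common factor, so where
  \<open>s\<^sub>i \<noteq> 0\<close> the point \<open>[s\<^sub>0 : \<dots> : s\<^sub>N]\<close> is recovered by a coordinate projection.\<close>

definition veronese :: "nat \<Rightarrow> nat \<Rightarrow> (nat \<Rightarrow> 'i \<Rightarrow> 'a \<Rightarrow> complex) \<Rightarrow> nat \<Rightarrow> 'i \<Rightarrow> 'a \<Rightarrow> complex" where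
  "veronese N k s l = (\<lambda>\<alpha> x. s (l div Suc N) \<alpha> x ^ (k - 1) * s (l mod Suc N) \<alpha> x)"

text \<open>There are \<open>Suc N * Suc N\<close> products, and homogeneous coordinates are
  numbered from 0.\<close>

definition veronese_dim :: "nat \<Rightarrow> nat" where
  "veronese_dim N = Suc N * Suc N - 1"

lemma veronese_index:
  assumes "i \<le> N" "j \<le> N"
  shows "i * Suc N + j \<le> veronese_dim N" "(i * Suc N + j) div Suc N = i" "(i * Suc N + j) mod Suc N = j"
proof -
  have "i * Suc N \<le> N * Suc N"
    using assms by (intro mult_right_mono) auto
  then show "i * Suc N + j \<le> veronese_dim N"
    using assms by (simp add: veronese_dim_def)
  show "(i * Suc N + j) div Suc N = i"
    using assms by (metis Suc_n_not_le_n add.commute add_0 div_less div_mult_self3 le_imp_less_Suc nat.distinct(1))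
  show "(i * Suc N + j) mod Suc N = j"
    using assms by (metis add.commute le_imp_less_Suc mod_less mod_mult_self1)
qed

lemma veronese_index_bounds:
  assumes "l \<le> veronese_dim N"
  shows "l div Suc N \<le> N" "l mod Suc N \<le> N"
proof -
  have "l < Suc N * Suc N"
    using assms by (simp add: veronese_dim_def)
  then show "l div Suc N \<le> N"
    using less_mult_imp_div_less less_Suc_eq_le by blast
  show "l mod Suc N \<le> N"
    using mod_less_divisor[of "Suc N" l] by simp
qed

lemma holomorphic_section_veronese:
  assumes "\<And>j. j \<le> N \<Longrightarrow> holomorphic_section X E (s j)" "k > 0" "l \<le> veronese_dim N"
  shows "holomorphic_section X (tensor_power E k) (veronese N k s l)"
proof -
  \<comment> \<open>The factors have degrees \<open>m\<close> and 1, so their transition factors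
    multiply to the power \<open>Suc m\<close>, which is \<open>k\<close>. For \<open>k = 0\<close>
    the truncated \<open>k - 1\<close> would give the wrong degree.\<close>
  obtain m where k: "k = Suc m"
    using assms(2) gr0_implies_Suc by blast
  define i j where "i = l div Suc N" and "j = l mod Suc N"
  have ij: "holomorphic_section X E (s i)" "holomorphic_section X E (s j)"
    using assms(1) veronese_index_bounds[OF assms(3)] by (simp_all add: i_def j_def)
  have v: "veronese N k s l = (\<lambda>\<alpha> x. s i \<alpha> x ^ m * s j \<alpha> x)"
    by (simp add: veronese_def i_def j_def k)
  show ?thesis
    unfolding holomorphic_section_def v
  proof (intro conjI ballI)
    fix \<alpha> assume "\<alpha> \<in> lb_index (tensor_power E k)"
    then show "holomorphic_fun_on X (lb_dom (tensor_power E k) \<alpha>) (\<lambda>x. s i \<alpha> x ^ m * s j \<alpha> x)"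
      using ij by (auto simp: holomorphic_section_def intro!: holomorphic_fun_on_mult holomorphic_fun_on_power)
  next
    fix \<alpha> \<beta> x
    assume "\<alpha> \<in> lb_index (tensor_power E k)" "\<beta> \<in> lb_index (tensor_power E k)"
      "x \<in> lb_dom (tensor_power E k) \<alpha> \<inter> lb_dom (tensor_power E k) \<beta>"
    then have "s i \<alpha> x = lb_trans E \<alpha> \<beta> x * s i \<beta> x" "s j \<alpha> x = lb_trans E \<alpha> \<beta> x * s j \<beta> x"
      using ij by (auto intro: section_transform)
    then show "s i \<alpha> x ^ m * s j \<alpha> x = lb_trans (tensor_power E k) \<alpha> \<beta> x * (s i \<beta> x ^ m * s j \<beta> x)"
      by (simp add: k power_mult_distrib)
  qed
qed

lemma linear_system_veronese:
  assumes "linear_system X E N s" "k > 0"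
  shows "linear_system X (tensor_power E k) (veronese_dim N) (veronese N k s)"
proof
  interpret linear_system X E N s by fact
  show "complex_manifold X" "holomorphic_line_bundle X (tensor_power E k)"
    using manifold holomorphic_line_bundle_tensor_power[OF lb] .
  show "holomorphic_section X (tensor_power E k) (veronese N k s l)" if "l \<le> veronese_dim N" for l
    using holomorphic_section_veronese[OF sections assms(2) that] .
  fix x assume "x \<in> cpoints X"
  then obtain i where i: "i \<le> N" "section_nonzero_at E (s i) x"
    using base_point_free by blast
  \<comment> \<open>The index of the pair \<open>(i, i)\<close>: its product is
    \<open>s_i^k\<close>, nonzero wherever \<open>s_i\<close> is.\<close>
  then have "section_nonzero_at (tensor_power E k) (veronese N k s (i * Suc N + i)) x"
    using veronese_index[OF i(1) i(1)] by (simp add: section_nonzero_at_def veronese_def)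
  then show "\<exists>l\<le>veronese_dim N. section_nonzero_at (tensor_power E k) (veronese N k s l) x"
    using veronese_index(1)[OF i(1) i(1)] by blast
qed

text \<open>With the homogeneous coordinates arranged as a square matrix, this is its row
  \<open>i\<close>. It is linear, and induces a map of projective spaces only away from its
  kernel.\<close>

definition block :: "nat \<Rightarrow> nat \<Rightarrow> (nat \<Rightarrow> complex) \<Rightarrow> nat \<Rightarrow> complex" where
  "block N i w = (\<lambda>j. if j \<le> N then w (i * Suc N + j) else 0)"

lemma block_scale: "block N i (\<lambda>l. a * w l) = (\<lambda>j. a * block N i w j)"
  by (auto simp: block_def)

lemma continuous_map_block:
  "continuous_map (complex_space n) (complex_space (Suc N)) (block N i)"
proof -
  have "continuous_map (complex_space n) euclidean (\<lambda>w. block N i w j)" for j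
    by (cases "j \<le> N") (simp_all add: block_def continuous_map_complex_space_nth)
  then show ?thesis
    by (auto simp: continuous_map_into_complex_space block_def)
qed

text \<open>The cone over the union of the preimages of \<open>O'\<close> under the partially
  defined row projections. Off the Veronese image different rows may give different points; only the
  trace of this set on the image matters.\<close>

definition block_preimage :: "nat \<Rightarrow> (nat \<Rightarrow> complex) set set \<Rightarrow> (nat \<Rightarrow> complex) set" where
  "block_preimage N O' = {w \<in> topspace (punctured_complex_space (Suc (veronese_dim N))).
     \<exists>i\<le>N. block N i w \<noteq> (\<lambda>_. 0) \<and> cline (block N i w) \<in> O'}"

lemma openin_block_preimage:
  assumes "openin (projective_top N) O'"
  shows "openin (punctured_complex_space (Suc (veronese_dim N))) (block_preimage N O')"
proof -
  define n where "n = Suc (veronese_dim N)"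
  define A where "A = {z \<in> topspace (punctured_complex_space (Suc N)). cline z \<in> O'}"
  have "openin (complex_space (Suc N)) A"
    using assms openin_projective_top openin_punctured_complex_space unfolding A_def by blast
  then have op: "openin (complex_space n) {w \<in> topspace (complex_space n). block N i w \<in> A}" for i
    using openin_continuous_map_preimage[OF continuous_map_block] by blast
  \<comment> \<open>Membership of a row in \<open>A\<close> says both that the row is nonzero and
    that its line lies in \<open>O'\<close>. It also excludes \<open>w = 0\<close>, whose rows all
    vanish.\<close>
  have "block_preimage N O' = (\<Union>i\<in>{..N}. {w \<in> topspace (complex_space n). block N i w \<in> A})"
  proof -
    have "block N i (\<lambda>_. 0) = (\<lambda>_. 0)" for i
      by (auto simp: block_def)
    then show ?thesis
      unfolding block_preimage_def A_def n_def[symmetric] by (auto simp: block_def)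
  qed
  moreover have "openin (complex_space n) (\<Union>i\<in>{..N}. {w \<in> topspace (complex_space n). block N i w \<in> A})"
    using op by blast
  moreover have "(\<lambda>_. 0) \<notin> block_preimage N O'"
    by (simp add: block_preimage_def)
  ultimately show ?thesis
    unfolding openin_punctured_complex_space n_def by simp
qed

text \<open>The set is saturated: rows scale linearly, so it is stable under nonzero scalars. Its
  image is therefore open in the quotient topology as soon as it is open itself.\<close>

lemma cline_in_block_preimage:
  assumes "w \<in> topspace (punctured_complex_space (Suc (veronese_dim N)))"
  shows "cline w \<in> cline ` block_preimage N O' \<longleftrightarrow> w \<in> block_preimage N O'"
proof
  assume "cline w \<in> cline ` block_preimage N O'"
  then obtain w' where w': "w' \<in> block_preimage N O'" "cline w = cline w'" by blast
  obtain a where a: "w = (\<lambda>l. a * w' l)"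
    using cline_eqD[OF w'(2)] .
  have "a \<noteq> 0"
    using assms by (auto simp: a)
  obtain i where "i \<le> N" "block N i w' \<noteq> (\<lambda>_. 0)" "cline (block N i w') \<in> O'"
    using w'(1) by (auto simp: block_preimage_def)
  then have "block N i w \<noteq> (\<lambda>_. 0)" "cline (block N i w) \<in> O'"
    using \<open>a \<noteq> 0\<close> by (auto simp: a block_scale cline_scale fun_eq_iff)
  then show "w \<in> block_preimage N O'"
    using assms \<open>i \<le> N\<close> by (auto simp: block_preimage_def)
qed auto

lemma openin_cline_block_preimage:
  assumes "openin (projective_top N) O'"
  shows "openin (projective_top (veronese_dim N)) (cline ` block_preimage N O')"
proof -
  have "{w \<in> topspace (punctured_complex_space (Suc (veronese_dim N))). cline w \<in> cline ` block_preimage N O'}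
      = block_preimage N O'"
    using cline_in_block_preimage unfolding block_preimage_def by blast
  moreover have "block_preimage N O' \<subseteq> topspace (punctured_complex_space (Suc (veronese_dim N)))"
    by (auto simp: block_preimage_def)
  ultimately show ?thesis
    using openin_block_preimage[OF assms] unfolding openin_projective_top by (simp add: image_mono)
qed

section \<open>Recovering the original map from the Veronese map\<close>

context
  fixes X :: "'a cmanifold" and E :: "('i, 'a) line_bundle"
    and N k :: nat and s :: "nat \<Rightarrow> 'i \<Rightarrow> 'a \<Rightarrow> complex"
  assumes ls: "linear_system X E N s" and k: "k > 0"
begin

interpretation S: linear_system X E N s
  by (fact ls)

interpretation V: linear_system X "tensor_power E k" "veronese_dim N" "veronese N k s"
  by (rule linear_system_veronese[OF ls k])

lemma block_veronese:
  assumes "i \<le> N"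
  shows "block N i (V.tuple \<alpha> x) = (\<lambda>j. s i \<alpha> x ^ (k - 1) * S.tuple \<alpha> x j)"
  using veronese_index[OF assms]
  by (auto simp del: mult_Suc_right simp: block_def V.tuple_def S.tuple_def veronese_def fun_eq_iff)

text \<open>Every nonzero row gives the same point. The condition is on the row and not on
  \<open>s_i\<close>, which covers \<open>k = 1\<close> too: there all rows equal the original
  tuple, even where \<open>s_i\<close> vanishes.\<close>

lemma cline_block_veronese:
  assumes "\<alpha> \<in> lb_index E" "x \<in> lb_dom E \<alpha>" "i \<le> N" "block N i (V.tuple \<alpha> x) \<noteq> (\<lambda>_. 0)"
  shows "cline (block N i (V.tuple \<alpha> x)) = S.lsmap x"
proof -
  have "s i \<alpha> x ^ (k - 1) \<noteq> 0"
    using assms(4) unfolding block_veronese[OF assms(3)] by auto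
  from cline_scale[OF this] show ?thesis
    unfolding block_veronese[OF assms(3)] S.lsmap_eq[OF assms(1,2)] .
qed

lemma block_veronese_nonzero:
  assumes "\<alpha> \<in> lb_index E" "x \<in> lb_dom E \<alpha>"
  obtains i where "i \<le> N" "block N i (V.tuple \<alpha> x) \<noteq> (\<lambda>_. 0)"
proof -
  obtain i where i: "i \<le> N" "s i \<alpha> x \<noteq> 0"
    using S.tuple_nonzero[OF assms] .
  then have "block N i (V.tuple \<alpha> x) i \<noteq> 0"
    unfolding block_veronese[OF i(1)] by (simp add: S.tuple_def)
  then show ?thesis
    using that[OF i(1)] by force
qed

text \<open>\<open>O'\<close> is arbitrary: open sets will give openness of the new map onto its
  image, singletons its injectivity.\<close>

lemma veronese_lsmap_in_iff:
  assumes "x \<in> cpoints X"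
  shows "V.lsmap x \<in> cline ` block_preimage N O' \<longleftrightarrow> S.lsmap x \<in> O'"
proof -
  define \<alpha> where "\<alpha> = lb_index_at E x"
  have \<alpha>: "\<alpha> \<in> lb_index E" "x \<in> lb_dom E \<alpha>"
    using lb_index_at[OF S.lb assms] by (simp_all add: \<alpha>_def)
  have V: "V.tuple \<alpha> x \<in> topspace (punctured_complex_space (Suc (veronese_dim N)))"
    using V.tuple_punctured \<alpha> by simp
  have "V.lsmap x \<in> cline ` block_preimage N O' \<longleftrightarrow> V.tuple \<alpha> x \<in> block_preimage N O'"
    using cline_in_block_preimage[OF V] V.lsmap_eq \<alpha> by simp
  also have "\<dots> \<longleftrightarrow> S.lsmap x \<in> O'"
  proof
    assume "V.tuple \<alpha> x \<in> block_preimage N O'"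
    then show "S.lsmap x \<in> O'"
      using cline_block_veronese[OF \<alpha>] unfolding block_preimage_def by force
  next
    assume "S.lsmap x \<in> O'"
    moreover obtain i where i: "i \<le> N" "block N i (V.tuple \<alpha> x) \<noteq> (\<lambda>_. 0)"
      using block_veronese_nonzero[OF \<alpha>] .
    ultimately have "cline (block N i (V.tuple \<alpha> x)) \<in> O'"
      using cline_block_veronese[OF \<alpha> i] by simp
    then show "V.tuple \<alpha> x \<in> block_preimage N O'"
      using V i unfolding block_preimage_def by blast
  qed
  finally show ?thesis .
qed

lemma veronese_lsmap_eqD:
  assumes "x \<in> cpoints X" "y \<in> cpoints X" "V.lsmap x = V.lsmap y"
  shows "S.lsmap x = S.lsmap y"
  using veronese_lsmap_in_iff[of x "{S.lsmap x}"] veronese_lsmap_in_iff[of y "{S.lsmap x}"] assms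
  by simp

text \<open>An open set of \<open>X\<close> is cut out by some open \<open>O'\<close> through the
  original embedding; the open set built from the rows then cuts it out through the new map.\<close>

lemma embedding_map_veronese:
  assumes "embedding_map (ctop X) (projective_top N) S.lsmap"
  shows "embedding_map (ctop X) (projective_top (veronese_dim N)) V.lsmap"
proof -
  let ?PS = "subtopology (projective_top N) (S.lsmap ` cpoints X)"
  let ?PV = "subtopology (projective_top (veronese_dim N)) (V.lsmap ` cpoints X)"
  have S: "homeomorphic_map (ctop X) ?PS S.lsmap"
    using assms by (simp add: embedding_map_def)
  have S_inj: "inj_on S.lsmap (cpoints X)"
    using homeomorphic_imp_injective_map[OF S] .
  have "homeomorphic_map (ctop X) ?PV V.lsmap"
  proof (rule bijective_open_imp_homeomorphic_map)
    show "continuous_map (ctop X) ?PV V.lsmap"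
      using V.continuous_lsmap by (auto simp: continuous_map_in_subtopology)
    then show "V.lsmap ` cpoints X = topspace ?PV"
      by (auto simp: continuous_map_def)
    show "inj_on V.lsmap (cpoints X)"
      using S_inj veronese_lsmap_eqD by (meson inj_onD inj_onI)
    show "open_map (ctop X) ?PV V.lsmap"
      unfolding open_map_def
    proof (intro allI impI)
      fix U assume U: "openin (ctop X) U"
      then have "openin ?PS (S.lsmap ` U)"
        using homeomorphic_imp_open_map[OF S] by (simp add: open_map_def)
      then obtain O' where O': "openin (projective_top N) O'" "S.lsmap ` U = O' \<inter> S.lsmap ` cpoints X"
        by (auto simp: openin_subtopology)
      \<comment> \<open>Injectivity of the original map enters here: \<open>S.lsmap x\<close> lying
        in the image of \<open>U\<close> must force \<open>x\<close> into \<open>U\<close>.\<close>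
      have "x \<in> U \<longleftrightarrow> V.lsmap x \<in> cline ` block_preimage N O'" if "x \<in> cpoints X" for x
        using veronese_lsmap_in_iff[OF that] O'(2) openin_subset[OF U] that S_inj
        by (metis IntD1 IntI image_eqI inj_on_image_mem_iff)
      then have "V.lsmap ` U = cline ` block_preimage N O' \<inter> V.lsmap ` cpoints X"
        using openin_subset[OF U] by blast
      then show "openin ?PV (V.lsmap ` U)"
        using openin_cline_block_preimage[OF O'(1)] by (simp add: openin_subtopology_Int)
    qed
  qed
  then show ?thesis
    by (simp add: embedding_map_def)
qed

text \<open>Near a point where \<open>s\<^sub>i\<^bsup>k-1\<^esup> s\<^sub>j \<noteq> 0\<close>, the affine coordinates \<open>s\<^sub>a / s\<^sub>j\<close> of the original map
  are among the affine coordinates of the Veronese map.\<close>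

lemma immersive_veronese:
  assumes "immersive X (projective_space N) S.lsmap"
  shows "immersive X (projective_space (veronese_dim N)) V.lsmap"
  unfolding immersive_def
proof (intro ballI impI allI)
  fix p c d v j0
  assume p: "p \<in> cpoints X" and c: "c \<in> catlas X" "p \<in> fst c"
    and d: "d \<in> catlas (projective_space (veronese_dim N))" "V.lsmap p \<in> fst d"
    and v: "\<forall>i<cdim (projective_space (veronese_dim N)).
        (\<Sum>j<cdim X. chart_pd c j (\<lambda>q. snd d (V.lsmap q) i) p * v j) = 0"
    and j0: "j0 < cdim X"
  define \<alpha> where "\<alpha> = lb_index_at E p"
  have \<alpha>: "\<alpha> \<in> lb_index E" "p \<in> lb_dom E \<alpha>"
    using lb_index_at[OF S.lb p] by (simp_all add: \<alpha>_def)
  obtain l where l: "l \<le> veronese_dim N" "d = projective_chart (veronese_dim N) l"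
    using d(1) by auto
  \<comment> \<open>The chart \<open>l\<close> lives where \<open>s_i^(k-1) s_j\<close> is nonzero,
    so the row to project to is \<open>i\<close> and the chart to use for the original map is
    \<open>j\<close>.\<close>
  define i j where "i = l div Suc N" and "j = l mod Suc N"
  have ij: "i \<le> N" "j \<le> N" "l = i * Suc N + j"
    using veronese_index_bounds[OF l(1)] by (simp_all only: i_def j_def div_mult_mod_eq)
  define W where "W = {x \<in> lb_dom E \<alpha>. veronese N k s l \<alpha> x \<noteq> 0}"
  have W: "openin (ctop X) W"
    using V.openin_nonzero_representative[of \<alpha> l] \<alpha> l(1) by (simp add: W_def)
  have pW: "p \<in> W"
    using V.lsmap_in_chart_iff[of \<alpha> p l] \<alpha> l d(2) by (simp add: W_def)
  have ver: "veronese N k s (i * Suc N + a) \<alpha> x = s i \<alpha> x ^ (k - 1) * s a \<alpha> x" if "a \<le> N" for a x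
    using veronese_index[OF ij(1) that] by (simp add: veronese_def)
  have nz: "s i \<alpha> x ^ (k - 1) \<noteq> 0" "s j \<alpha> x \<noteq> 0" if "x \<in> W" for x
    using that ver[OF ij(2)] unfolding W_def ij(3)[symmetric] by auto
  define d' where "d' = projective_chart N j"
  have d': "d' \<in> catlas (projective_space N)" "S.lsmap p \<in> fst d'"
    using ij S.lsmap_in_chart_iff[OF \<alpha> ij(2)] nz(2)[OF pW] by (simp_all add: d'_def)
  have "(\<Sum>m<cdim X. chart_pd c m (\<lambda>q. snd d' (S.lsmap q) a) p * v m) = 0" if a: "a < N" for a
  proof -
    \<comment> \<open>Affine coordinates in chart \<open>j\<close> skip the homogeneous index
      \<open>j\<close>; \<open>a'\<close> is the homogeneous index behind the affine index
      \<open>a\<close>.\<close>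
    define a' where "a' = (if a < j then a else Suc a)"
    have a': "a' \<le> N" "a' \<noteq> j"
      using a by (auto simp: a'_def)
    define t where "t = i * Suc N + a'"
    have t: "t \<noteq> l" "t \<le> veronese_dim N"
      using a' veronese_index(1)[OF ij(1) a'(1)] ij(3) by (simp_all add: t_def)
    \<comment> \<open>Conversely, \<open>b\<close> is the affine position of the homogeneous index
      \<open>t\<close> in chart \<open>l\<close>, where \<open>l\<close> is skipped. It exists
      because \<open>a'\<close> differs from \<open>j\<close>, hence \<open>t\<close> from
      \<open>l\<close>.\<close>
    define b where "b = (if t < l then t else t - 1)"
    have b: "b < veronese_dim N" "(if b < l then b else Suc b) = t"
      using t l(1) by (auto simp: b_def)
    have "chart_pd c m (\<lambda>q. snd d' (S.lsmap q) a) p = chart_pd c m (\<lambda>q. snd d (V.lsmap q) b) p"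
      if "m < cdim X" for m
    proof (rule chart_pd_cong[OF S.manifold c W pW _ that])
      fix q assume q: "q \<in> W"
      then have qd: "q \<in> lb_dom E \<alpha>" "veronese N k s l \<alpha> q \<noteq> 0"
        by (simp_all add: W_def)
      have "snd d (V.lsmap q) b = veronese N k s t \<alpha> q / veronese N k s l \<alpha> q"
        using V.lsmap_coordinate[of \<alpha> q l b] \<alpha>(1) qd l b by simp
      \<comment> \<open>Numerator and denominator lie in the same row \<open>i\<close>, so the
        common factor \<open>s_i^(k-1)\<close> cancels.\<close>
      also have "\<dots> = s a' \<alpha> q / s j \<alpha> q"
        using nz(1)[OF q] unfolding t_def ij(3) ver[OF a'(1)] ver[OF ij(2)]
        by (rule mult_divide_mult_cancel_left)
      also have "\<dots> = snd d' (S.lsmap q) a"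
        using S.lsmap_coordinate[OF \<alpha>(1) qd(1) ij(2) nz(2)[OF q] a] by (simp add: d'_def a'_def)
      finally show "snd d' (S.lsmap q) a = snd d (V.lsmap q) b"
        by simp
    qed
    then have "(\<Sum>m<cdim X. chart_pd c m (\<lambda>q. snd d' (S.lsmap q) a) p * v m) =
        (\<Sum>m<cdim X. chart_pd c m (\<lambda>q. snd d (V.lsmap q) b) p * v m)"
      by (intro sum.cong) auto
    then show ?thesis
      using v b(1) by simp
  qed
  then show "v j0 = 0"
    using assms[unfolded immersive_def, rule_format, OF p c(1) d'(1) c(2) d'(2) _ j0] by simp
qed

lemma holomorphic_embedding_veronese:
  assumes "holomorphic_embedding X (projective_space N) S.lsmap"
  shows "holomorphic_embedding X (projective_space (veronese_dim N)) V.lsmap"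
  using assms V.holomorphic_lsmap immersive_veronese embedding_map_veronese
  by (simp add: holomorphic_embedding_def)

end

section \<open>Very ampleness and ampleness of tensor powers\<close>

lemma very_ample_tensor_power:
  assumes "complex_manifold X" "holomorphic_line_bundle X E" "very_ample X E" "k > 0"
  shows "very_ample X (tensor_power E k)"
proof -
  obtain N s where s: "\<forall>j\<le>N. holomorphic_section X E (s j)"
      "\<forall>x\<in>cpoints X. \<exists>j\<le>N. section_nonzero_at E (s j) x"
    and emb: "holomorphic_embedding X (projective_space N) (linear_system_map E N s)"
    using assms(3) unfolding very_ample_def by blast
  have ls: "linear_system X E N s"
    by unfold_locales (use assms s in auto)
  interpret V: linear_system X "tensor_power E k" "veronese_dim N" "veronese N k s"
    by (rule linear_system_veronese[OF ls assms(4)])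
  show ?thesis
    unfolding very_ample_def
    using V.sections V.base_point_free holomorphic_embedding_veronese[OF ls assms(4) emb] by blast
qed

text \<open>If the \<open>m\<close>-th power of \<open>E\<close> is very ample, so is the
  \<open>k\<close>-th power of that power, which is also the \<open>m\<close>-th power of
  \<open>tensor_power E k\<close>. The same exponent \<open>m\<close> works.\<close>

lemma ample_tensor_power:
  assumes "complex_manifold X" "holomorphic_line_bundle X E" "ample X E" "k > 0"
  shows "ample X (tensor_power E k)"
  using assms very_ample_tensor_power[OF assms(1) holomorphic_line_bundle_tensor_power[OF assms(2)]]
  unfolding ample_def by (metis tensor_power_tensor_power)


section \<open>Divisors of powers of sections\<close>

lemma holomorphic_section_power:
  assumes "holomorphic_section X E s"
  shows "holomorphic_section X (tensor_power E k) (\<lambda>\<alpha> x. s \<alpha> x ^ k)"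
proof -
  have "s \<alpha> x ^ k = lb_trans E \<alpha> \<beta> x ^ k * s \<beta> x ^ k"
    if "\<alpha> \<in> lb_index E" "\<beta> \<in> lb_index E" "x \<in> lb_dom E \<alpha>" "x \<in> lb_dom E \<beta>" for \<alpha> \<beta> x
    using section_transform[OF assms that] by (simp add: power_mult_distrib)
  moreover have "holomorphic_fun_on X (lb_dom E \<alpha>) (\<lambda>x. s \<alpha> x ^ k)" if "\<alpha> \<in> lb_index E" for \<alpha>
    using assms that by (auto simp: holomorphic_section_def intro!: holomorphic_fun_on_power)
  ultimately show ?thesis
    unfolding holomorphic_section_def tensor_power_sel by blast
qed

text \<open>Any local equation differs from \<open>s\<close> by a unit, so it vanishes only where
  \<open>s\<close> does. Conversely the representative \<open>s \<alpha>\<close> is itself a local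
  equation on its domain, the units being the transition functions.\<close>

lemma divisor_support_divisor_of:
  assumes "holomorphic_line_bundle X E" "holomorphic_section X E s"
  shows "divisor_support (divisor_of X E s) = {x \<in> cpoints X. \<not> section_nonzero_at E s x}"
proof (intro set_eqI iffI)
  fix x assume "x \<in> divisor_support (divisor_of X E s)"
  then obtain U f where U: "openin (ctop X) U" "x \<in> U" "f x = 0"
    and f: "\<forall>\<alpha>\<in>lb_index E. \<exists>u. holomorphic_fun_on X (U \<inter> lb_dom E \<alpha>) u \<and>
        (\<forall>x\<in>U \<inter> lb_dom E \<alpha>. u x \<noteq> 0 \<and> f x = u x * s \<alpha> x)"
    by (auto simp: divisor_support_def divisor_of_def)
  have x: "x \<in> cpoints X"
    using U openin_subset by blast
  with f U have "s (lb_index_at E x) x = 0"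
    using lb_index_at[OF assms(1) x] by (metis IntI mult_eq_0_iff)
  with x show "x \<in> {x \<in> cpoints X. \<not> section_nonzero_at E s x}"
    by (simp add: section_nonzero_at_def)
next
  fix x assume x: "x \<in> {x \<in> cpoints X. \<not> section_nonzero_at E s x}"
  define \<alpha> where "\<alpha> = lb_index_at E x"
  have \<alpha>: "\<alpha> \<in> lb_index E" "x \<in> lb_dom E \<alpha>" "s \<alpha> x = 0"
    using lb_index_at[OF assms(1)] x by (simp_all add: \<alpha>_def section_nonzero_at_def)
  have "holomorphic_fun_on X (lb_dom E \<alpha> \<inter> lb_dom E \<beta>) (lb_trans E \<alpha> \<beta>) \<and>
      (\<forall>x\<in>lb_dom E \<alpha> \<inter> lb_dom E \<beta>. lb_trans E \<alpha> \<beta> x \<noteq> 0 \<and> s \<alpha> x = lb_trans E \<alpha> \<beta> x * s \<beta> x)"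
    if "\<beta> \<in> lb_index E" for \<beta>
    using assms that \<alpha>(1) unfolding holomorphic_line_bundle_def holomorphic_section_def by blast
  moreover have "openin (ctop X) (lb_dom E \<alpha>)" "holomorphic_fun_on X (lb_dom E \<alpha>) (s \<alpha>)"
    using lb_dom_open(1)[OF assms(1) \<alpha>(1)] assms(2) \<alpha>(1) by (auto simp: holomorphic_section_def)
  ultimately have "(lb_dom E \<alpha>, s \<alpha>) \<in> divisor_of X E s"
    unfolding divisor_of_def by blast
  with \<alpha> show "x \<in> divisor_support (divisor_of X E s)"
    unfolding divisor_support_def by blast
qed

text \<open>The divisor of \<open>s^k\<close> carries other multiplicities than \<open>D\<close>,
  but the complement sees only the support, and for \<open>k > 0\<close> the zeros of
  \<open>s^k\<close> are those of \<open>s\<close>. The complements are equal, not merely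
  isomorphic, so their properties transfer by rewriting.\<close>

lemma complete_linear_system_tensor_power:
  assumes "holomorphic_line_bundle X E" "k > 0" "D \<in> complete_linear_system X E"
  obtains D' where "D' \<in> complete_linear_system X (tensor_power E k)"
    "divisor_complement X D' = divisor_complement X D"
proof -
  obtain s where s: "D = divisor_of X E s" "holomorphic_section X E s" "nontrivial_section X E s"
    using assms(3) by (auto simp: complete_linear_system_def)
  let ?t = "\<lambda>\<alpha> x. s \<alpha> x ^ k"
  have nz: "section_nonzero_at (tensor_power E k) ?t = section_nonzero_at E s"
    using assms(2) by (simp add: section_nonzero_at_def fun_eq_iff)
  have t: "holomorphic_section X (tensor_power E k) ?t"
    using s(2) by (rule holomorphic_section_power)
  have "nontrivial_section X (tensor_power E k) ?t"
    using s(3) by (simp only: nontrivial_section_def nz)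
  with t have "divisor_of X (tensor_power E k) ?t \<in> complete_linear_system X (tensor_power E k)"
    unfolding complete_linear_system_def by (intro CollectI exI[of _ ?t] conjI) simp
  moreover have "divisor_support (divisor_of X (tensor_power E k) ?t) = divisor_support D"
    unfolding s(1) divisor_support_divisor_of[OF assms(1) s(2)]
      divisor_support_divisor_of[OF holomorphic_line_bundle_tensor_power[OF assms(1)] t] nz by (rule refl)
  ultimately show ?thesis
    using that by (simp add: divisor_complement_def)
qed

theorem proposition4p2:
  fixes X :: "'a cmanifold" and E :: "('i, 'a) line_bundle" and k :: nat
  assumes "polarised_manifold X E"
    and "polarised_density_property X E"
    and "k > 0"
  shows "polarised_manifold X (tensor_power E k) \<and>
    polarised_density_property X (tensor_power E k)"
proof
  have E: "complex_manifold X" "holomorphic_line_bundle X E" "ample X E"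
    using assms(1) by (auto simp: polarised_manifold_def)
  show "polarised_manifold X (tensor_power E k)"
    using assms(1) ample_tensor_power[OF E assms(3)] holomorphic_line_bundle_tensor_power[OF E(2)]
    by (simp add: polarised_manifold_def)
  show "polarised_density_property X (tensor_power E k)"
    unfolding polarised_density_property_def
  proof
    fix x assume "x \<in> cpoints X"
    then obtain D where D: "D \<in> complete_linear_system X E" "x \<in> cpoints (divisor_complement X D)"
        "stein_manifold (divisor_complement X D)" "density_property (divisor_complement X D)"
      using assms(2) unfolding polarised_density_property_def by blast
    obtain D' where D': "D' \<in> complete_linear_system X (tensor_power E k)"
        "divisor_complement X D' = divisor_complement X D"
      using complete_linear_system_tensor_power[OF E(2) assms(3) D(1)] .
    show "\<exists>D\<in>complete_linear_system X (tensor_power E k). x \<in> cpoints (divisor_complement X D) \<and>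
        stein_manifold (divisor_complement X D) \<and> density_property (divisor_complement X D)"
      using D(2-4) by (intro bexI[OF _ D'(1)]) (simp add: D'(2))
  qed
qed

end
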